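(* The Batalin–Vilkovisky Laplacian $\Delta$ is a differential on the space of noncommutative local functionals over the infinite jet superspace: $\Delta^2=0$.
   Context: **Letters and cyclic words.** The ground field is $\mathbb{R}$. $M^n$ is an oriented affine real manifold of dimension $n$, with local affine coordinates $x=(x^1,\dots,x^n)$ and a volume element $\mathrm{dvol}(x)$. The alphabet consists of even letters $a^i_\sigma$ (degree $0$) and odd letters $b_{j,\tau}$ (degree $1$), $1\le i,j\le m$, where $\sigma,\tau$ are multi-indices ($a^i=a^i_\varnothing$, $b_j=b_{j,\varnothing}$); $[a],[b]$ denote dependence on finitely many of these jet letters. The degree $|w|$ of a word is the number of its odd letters. A cyclic word $(w)$ is the class of an element $w$ of the free associative algebra on these letters (with coefficients in $C^\infty(M^n)$) modulo the linear relation $w\sim\mathfrak{t}(w)$, $\mathfrak{t}(\gamma_1\cdots\gamma_\lambda)=(-1)^{|\gamma_1\cdots\gamma_{\lambda-1}|\cdot|\gamma_\lambda|}\gamma_\lambda\gamma_1\cdots\gamma_{\lambda-1}$. For words of lengths $\lambda(w_1),\lambda(w_2)>0$ put $$(w_1)\times(w_2)=\frac{1}{\lambda(w_1)\lambda(w_2)}\sum_{i=1}^{\lambda(w_1)}\sum_{j=1}^{\lambda(w_2)}\bigl(\mathfrak{t}^{i-1}(w_1)\,\mathfrak{t}^{j-1}(w_2)\bigr),$$ extended bilinearly, zero-length words being scalars acting by multiplication. This product is graded commutative and not associative. The total derivative $D_{x^k}$ is the derivation equal to $\partial/\partial x^k$ on coefficients with $a^i_\sigma\mapsto a^i_{\sigma\cup\{k\}}$,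 $b_{j,\tau}\mapsto b_{j,\tau\cup\{k\}}$. **Functionals.** An integral functional is $F=\int f(x,[a],[b])\,\mathrm{dvol}(x)$ with $f$ a (sum of) cyclic word(s), modulo integration by parts without boundary terms (coefficients are smooth and, if $M^n$ is not closed, decay rapidly towards the boundary or infinity). The product of $F_1,F_2$ is $F_1\times F_2=\iint f_1|_{x_1}\times f_2|_{x_2}\,\mathrm{dvol}(x_1)\mathrm{dvol}(x_2)$ over $M^n\times M^n$. Local functionals are linear combinations of products of $\ell\ge0$ integral functionals (with a specified bracketing; default $(\cdots(F_1\times F_2)\times\cdots)\times F_\ell$). Each letter in such a product remembers the factor $F_\alpha$, and the copy of $M^n$, from which it comes; the total derivatives $D^{(\alpha)}$ over the $\alpha$-th copy act only on the letters and coefficients of the $\alpha$-th factor. **Derivatives.** $\overrightarrow\partial/\partial b_{i,\tau}$ acts on a cyclic word by deletion without changing the cyclic order of the remaining letters: $(c_1\cdots c_\lambda)\mapsto\sum_{\nu:\,c_\nu=b_{i,\tau}}(-1)^{|c_1\cdots c_{\nu-1}|}(c_1\cdots c_{\nu-1}c_{\nu+1}\cdots c_\lambda)$; similarly (without signs) for $\partial/\partial a^i_\sigma$. **BV Laplacian.** For an integral functional, $\Delta F=\int\sum_i\sum_{\sigma,\tau}(-D)^{\sigma\cup\tau}\frac{\overrightarrow\partial^2f}{\partial a^i_\sigma\,\partial b_{i,\tau}}\,\mathrm{dvol}(x)$. On a product with density word $h$, $\Delta$ acts by $\sum_{\alpha,\beta}\sum_i\sum_{\sigma,\tau}(-D^{(\alpha)})^\sigma(-D^{(\beta)})^\tau\frac{\overrightarrow\partial^{(\alpha)}}{\partial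 a^i_\sigma}\frac{\overrightarrow\partial^{(\beta)}}{\partial b_{i,\tau}}h$, where the superscripts say from which factor the deleted letter is taken and, for $\alpha\ne\beta$, the copies $\alpha,\beta$ of $M^n$ are identified along the diagonal $x_\alpha=x_\beta$. **Conventions for composed expressions.** (1) Multiplication first, variation afterwards: first the product word (with its bracketing) is formed, and then the operators act on the letters inside it. (2) When $\Delta$ is iterated, all partial derivatives act on the densities first, while the total derivatives (each over its own copy of $M^n$, acting only on what remains of the respective density) and the restriction to the diagonals are performed at the very end. *)

theory Defs
  imports
    "HOL-Analysis.Analysis"
    "HOL-Library.Multiset"
    "HOL-Library.Poly_Mapping"
    "HOL-Library.Function_Algebras"
begin

section \<open>Oriented affine manifolds\<close>

text \<open>The manifold is the whole Hausdorff, second countable type \<open>'m\<close>; its dimension is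
  \<open>CARD('n)\<close>.  A chart is an open domain together with its affine coordinates.\<close>

type_synonym ('m, 'n) chart = "'m set \<times> ('m \<Rightarrow> real ^ 'n)"

definition chart_inv :: "('m, 'n::finite) chart \<Rightarrow> real ^ 'n \<Rightarrow> 'm"
  where "chart_inv c = inv_into (fst c) (snd c)"

definition oriented_affine_atlas ::
    "('m::{t2_space, second_countable_topology}, 'n::finite) chart set \<Rightarrow> bool"
  where "oriented_affine_atlas \<A> \<longleftrightarrow>
    (\<Union>c\<in>\<A>. fst c) = UNIV \<and>
    (\<forall>c\<in>\<A>. open (fst c) \<and> open (snd c ` fst c) \<and>
       homeomorphism (fst c) (snd c ` fst c) (snd c) (chart_inv c)) \<and>
    (\<forall>c\<in>\<A>. \<forall>d\<in>\<A>. \<forall>p\<in>fst c \<inter> fst d. \<exists>L b. det L > 0 \<and>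
       (\<forall>\<^sub>F q in nhds p. snd d q = L *v snd c q + b))"

definition transition_jacobian ::
    "('m, 'n::finite) chart \<Rightarrow> ('m, 'n) chart \<Rightarrow> 'm \<Rightarrow> real ^ 'n ^ 'n"
  where "transition_jacobian c d p = jacobian (snd d \<circ> chart_inv c) (at (snd c p))"

text \<open>Points of \<open>M\<^sup>I\<close>, for a finite set \<open>I\<close> of factor labels, are represented by total
  functions \<open>nat \<Rightarrow> 'm\<close> of which only the values on \<open>I\<close> matter, and product charts by
  functions \<open>nat \<Rightarrow> ('m, 'n) chart\<close>.\<close>

definition chart_tuples :: "('m, 'n) chart set \<Rightarrow> (nat \<Rightarrow> ('m, 'n) chart) set"
  where "chart_tuples \<A> = {c. \<forall>\<alpha>. c \<alpha> \<in> \<A>}"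

definition tuple_domain :: "(nat \<Rightarrow> ('m, 'n) chart) \<Rightarrow> nat set \<Rightarrow> (nat \<Rightarrow> 'm) set"
  where "tuple_domain c I = {x. \<forall>\<alpha>\<in>I. x \<alpha> \<in> fst (c \<alpha>)}"

type_synonym 'm coeff = "(nat \<Rightarrow> 'm) \<Rightarrow> real"

definition coord_line ::
    "(nat \<Rightarrow> ('m, 'n::finite) chart) \<Rightarrow> nat \<Rightarrow> 'n \<Rightarrow> (nat \<Rightarrow> 'm) \<Rightarrow> real \<Rightarrow> (nat \<Rightarrow> 'm)"
  where "coord_line c \<alpha> k x t =
    x(\<alpha> := chart_inv (c \<alpha>) (snd (c \<alpha>) (x \<alpha>) + t *\<^sub>R axis k 1))"

definition coeff_deriv :: "(nat \<Rightarrow> ('m, 'n::finite) chart) \<Rightarrow> nat \<Rightarrow> 'n \<Rightarrow> 'm coeff \<Rightarrow> 'm coeff"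
  where "coeff_deriv c \<alpha> k f x = deriv (\<lambda>t. f (coord_line c \<alpha> k x t)) 0"

definition smooth_coeff ::
    "(nat \<Rightarrow> ('m::topological_space, 'n::finite) chart) \<Rightarrow> nat set \<Rightarrow> 'm coeff \<Rightarrow> bool"
  where "smooth_coeff c I f \<longleftrightarrow>
    (\<forall>x\<in>tuple_domain c I. \<forall>y\<in>tuple_domain c I. (\<forall>\<alpha>\<in>I. x \<alpha> = y \<alpha>) \<longrightarrow> f x = f y) \<and>
    (\<forall>ds. set ds \<subseteq> I \<times> UNIV \<longrightarrow>
      (let g = fold (\<lambda>(\<alpha>, k). coeff_deriv c \<alpha> k) ds f in
        continuous_on (tuple_domain c I) g \<and>
        (\<forall>x\<in>tuple_domain c I. \<forall>\<alpha>\<in>I. \<forall>k.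
           (\<lambda>t. g (coord_line c \<alpha> k x t)) differentiable at 0)))"

text \<open>In a chart \<open>c\<close> the volume element is \<open>vol c dx\<^sup>1 \<and> \<dots> \<and> dx\<^sup>n\<close>.\<close>

definition volume_element ::
    "('m::topological_space, 'n::finite) chart set \<Rightarrow> (('m, 'n) chart \<Rightarrow> 'm \<Rightarrow> real) \<Rightarrow> bool"
  where "volume_element \<A> vol \<longleftrightarrow>
    (\<forall>c\<in>\<A>. (\<forall>p\<in>fst c. vol c p > 0) \<and> smooth_coeff (\<lambda>_. c) {0} (\<lambda>x. vol c (x 0))) \<and>
    (\<forall>c\<in>\<A>. \<forall>d\<in>\<A>. \<forall>p\<in>fst c \<inter> fst d.
       vol c p = det (transition_jacobian c d p) * vol d p)"


section \<open>Words in jet letters\<close>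

text \<open>\<open>A i \<sigma>\<close> is the even letter \<open>a\<^sup>i\<^sub>\<sigma>\<close> and \<open>B i \<sigma>\<close> the odd letter \<open>b\<close> with lower index \<open>i, \<sigma>\<close>;
  \<open>CARD('r)\<close> is the number of the \<open>a\<^sup>i\<close>.  Inside words every letter carries the label of the
  factor from which it comes.\<close>

datatype ('r, 'n) jet_letter = A 'r "'n multiset" | B 'r "'n multiset"

type_synonym ('r, 'n) word = "(nat \<times> ('r, 'n) jet_letter) list"

type_synonym ('m, 'r, 'n) expr = "('r, 'n) word \<Rightarrow>\<^sub>0 'm coeff"

fun is_odd :: "('r, 'n) jet_letter \<Rightarrow> bool"
  where "is_odd (A i \<sigma>) = False" | "is_odd (B i \<sigma>) = True"

fun raise :: "'n \<Rightarrow> ('r, 'n) jet_letter \<Rightarrow> ('r, 'n) jet_letter"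
  where "raise k (A i \<sigma>) = A i (add_mset k \<sigma>)" | "raise k (B i \<sigma>) = B i (add_mset k \<sigma>)"

definition word_degree :: "('r, 'n) word \<Rightarrow> nat"
  where "word_degree w = length (filter (is_odd \<circ> snd) w)"

definition scale :: "'c::comm_ring_1 \<Rightarrow> ('k \<Rightarrow>\<^sub>0 'c) \<Rightarrow> ('k \<Rightarrow>\<^sub>0 'c)"
  where "scale c h = Poly_Mapping.map ((*) c) h"

definition rotate_word :: "('r, 'n) word \<Rightarrow> ('r, 'n) word"
  where "rotate_word w = (if w = [] then [] else last w # butlast w)"

definition rotate_sign :: "('r, 'n) word \<Rightarrow> 'c::comm_ring_1"
  where "rotate_sign w =
    (if w = [] then 1 else (- 1) ^ (word_degree (butlast w) * word_degree [last w]))"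

definition rotate_expr :: "(('r, 'n) word \<Rightarrow>\<^sub>0 'c::comm_ring_1) \<Rightarrow> (('r, 'n) word \<Rightarrow>\<^sub>0 'c)"
  where "rotate_expr h = (\<Sum>w\<in>Poly_Mapping.keys h.
    Poly_Mapping.single (rotate_word w) (rotate_sign w * Poly_Mapping.lookup h w))"

text \<open>Cyclic words are elements of the free associative algebra modulo the linear span of all
  \<open>w - t(w)\<close>, which is the image of \<open>1 - t\<close>.\<close>

definition cyclic_eq :: "(('r, 'n) word \<Rightarrow>\<^sub>0 real) \<Rightarrow> (('r, 'n) word \<Rightarrow>\<^sub>0 real) \<Rightarrow> bool"
  where "cyclic_eq p q \<longleftrightarrow> (\<exists>s. p - q = s - rotate_expr s)"

definition concat_expr :: "('m, 'r, 'n) expr \<Rightarrow> ('m, 'r, 'n) expr \<Rightarrow> ('m, 'r, 'n) expr"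
  where "concat_expr f g = (\<Sum>v\<in>Poly_Mapping.keys f. \<Sum>w\<in>Poly_Mapping.keys g.
    Poly_Mapping.single (v @ w) (Poly_Mapping.lookup f v * Poly_Mapping.lookup g w))"

definition cyclic_times_word :: "('r, 'n) word \<Rightarrow> ('r, 'n) word \<Rightarrow> ('m, 'r, 'n) expr"
  where "cyclic_times_word v w =
    (if v = [] \<or> w = [] then Poly_Mapping.single (v @ w) 1
     else scale (\<lambda>_. 1 / (real (length v) * real (length w)))
       (\<Sum>i = 1..length v. \<Sum>j = 1..length w.
          concat_expr ((rotate_expr ^^ (i - 1)) (Poly_Mapping.single v 1))
                      ((rotate_expr ^^ (j - 1)) (Poly_Mapping.single w 1))))"

definition cyclic_times :: "('m, 'r, 'n) expr \<Rightarrow> ('m, 'r, 'n) expr \<Rightarrow> ('m, 'r, 'n) expr"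
  where "cyclic_times f g = (\<Sum>v\<in>Poly_Mapping.keys f. \<Sum>w\<in>Poly_Mapping.keys g.
    scale (Poly_Mapping.lookup f v * Poly_Mapping.lookup g w) (cyclic_times_word v w))"

definition letter_deriv ::
    "nat \<times> ('r, 'n) jet_letter \<Rightarrow> ('m, 'r, 'n) expr \<Rightarrow> ('m, 'r, 'n) expr"
  where "letter_deriv l h = (\<Sum>w\<in>Poly_Mapping.keys h. \<Sum>\<nu> | \<nu> < length w \<and> w ! \<nu> = l.
    Poly_Mapping.single (take \<nu> w @ drop (Suc \<nu>) w)
      ((- 1) ^ (word_degree [l] * word_degree (take \<nu> w)) * Poly_Mapping.lookup h w))"

definition total_deriv ::
    "(nat \<Rightarrow> ('m, 'n::finite) chart) \<Rightarrow> nat \<Rightarrow> 'n \<Rightarrow> ('m, 'r, 'n) expr \<Rightarrow> ('m, 'r, 'n) expr"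
  where "total_deriv c \<alpha> k h = (\<Sum>w\<in>Poly_Mapping.keys h.
    Poly_Mapping.single w (coeff_deriv c \<alpha> k (Poly_Mapping.lookup h w)) +
    (\<Sum>\<nu> | \<nu> < length w \<and> fst (w ! \<nu>) = \<alpha>.
       Poly_Mapping.single (w[\<nu> := (\<alpha>, raise k (snd (w ! \<nu>)))]) (Poly_Mapping.lookup h w)))"


section \<open>Densities and integral functionals\<close>

text \<open>A density is given by its components in all product charts.  If \<open>y = L x + b\<close> then
  \<open>\<partial>/\<partial>x\<^sup>k = \<Sum>l. L $ l $ k \<partial>/\<partial>y\<^sup>l\<close>; correspondingly a letter with multi-index \<open>\<sigma>\<close> in the
  coordinates \<open>x\<close> is the combination of the letters with multi-indices \<open>\<tau>\<close> in the coordinates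
  \<open>y\<close>, taken with the coefficients of the monomials \<open>\<tau>\<close> in
  \<open>\<Prod>k\<in>#\<sigma>. (\<Sum>l. L $ l $ k Y\<^sub>l)\<close>.\<close>

type_synonym ('m, 'r, 'n) family = "(nat \<Rightarrow> ('m, 'n) chart) \<Rightarrow> ('m, 'r, 'n) expr"

definition index_change :: "real ^ 'n::finite ^ 'n \<Rightarrow> 'n multiset \<Rightarrow> ('n multiset \<Rightarrow>\<^sub>0 real)"
  where "index_change L \<sigma> = (\<Prod>k\<in>#\<sigma>. (\<Sum>l\<in>UNIV. Poly_Mapping.single {#l#} (L $ l $ k)))"

fun letter_change ::
    "real ^ 'n::finite ^ 'n \<Rightarrow> ('r, 'n) jet_letter \<Rightarrow> (('r, 'n) jet_letter \<Rightarrow>\<^sub>0 real)"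
  where
    "letter_change L (A i \<sigma>) = (\<Sum>\<tau>\<in>Poly_Mapping.keys (index_change L \<sigma>).
       Poly_Mapping.single (A i \<tau>) (Poly_Mapping.lookup (index_change L \<sigma>) \<tau>))"
  | "letter_change L (B i \<sigma>) = (\<Sum>\<tau>\<in>Poly_Mapping.keys (index_change L \<sigma>).
       Poly_Mapping.single (B i \<tau>) (Poly_Mapping.lookup (index_change L \<sigma>) \<tau>))"

fun word_change ::
    "(nat \<Rightarrow> real ^ 'n::finite ^ 'n) \<Rightarrow> ('r, 'n) word \<Rightarrow> (('r, 'n) word \<Rightarrow>\<^sub>0 real)"
  where
    "word_change L [] = Poly_Mapping.single [] 1"
  | "word_change L ((\<alpha>, l) # w) =
      (\<Sum>l'\<in>Poly_Mapping.keys (letter_change (L \<alpha>) l). \<Sum>w'\<in>Poly_Mapping.keys (word_change L w).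
         Poly_Mapping.single ((\<alpha>, l') # w')
           (Poly_Mapping.lookup (letter_change (L \<alpha>) l) l' *
            Poly_Mapping.lookup (word_change L w) w'))"

definition coordinate_change ::
    "(nat \<Rightarrow> real ^ 'n::finite ^ 'n) \<Rightarrow> (('r, 'n) word \<Rightarrow>\<^sub>0 real) \<Rightarrow> (('r, 'n) word \<Rightarrow>\<^sub>0 real)"
  where "coordinate_change L p = (\<Sum>w\<in>Poly_Mapping.keys p.
    scale (Poly_Mapping.lookup p w) (word_change L w))"

definition tuple_jacobian ::
    "(nat \<Rightarrow> ('m, 'n::finite) chart) \<Rightarrow> (nat \<Rightarrow> ('m, 'n) chart) \<Rightarrow> (nat \<Rightarrow> 'm) \<Rightarrow>
     nat \<Rightarrow> real ^ 'n ^ 'n"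
  where "tuple_jacobian c d x \<alpha> = transition_jacobian (c \<alpha>) (d \<alpha>) (x \<alpha>)"

definition at_point :: "('m, 'r, 'n) expr \<Rightarrow> (nat \<Rightarrow> 'm) \<Rightarrow> (('r, 'n) word \<Rightarrow>\<^sub>0 real)"
  where "at_point h x = Poly_Mapping.map (\<lambda>f. f x) h"

definition smooth_family ::
    "('m::topological_space, 'n::finite) chart set \<Rightarrow> nat set \<Rightarrow> ('m, 'r, 'n) family \<Rightarrow> bool"
  where "smooth_family \<A> I h \<longleftrightarrow>
    (\<exists>W. finite W \<and> W \<subseteq> lists (I \<times> UNIV) \<and>
       (\<forall>c\<in>chart_tuples \<A>. Poly_Mapping.keys (h c) \<subseteq> W)) \<and>
    (\<forall>c\<in>chart_tuples \<A>. \<forall>d\<in>chart_tuples \<A>. (\<forall>\<alpha>\<in>I. c \<alpha> = d \<alpha>) \<longrightarrow> h c = h d) \<and>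
    (\<forall>c\<in>chart_tuples \<A>. \<forall>w. smooth_coeff c I (Poly_Mapping.lookup (h c) w))"

text \<open>What rapid decay towards the boundary or infinity means depends on the manifold and is
  left as a parameter \<open>decay\<close>: any class of families forming a linear space, which imposes no
  condition if the manifold is closed.  Typical instances are compact supports or Schwartz
  functions.\<close>

definition decay_condition ::
    "('m::topological_space, 'n::finite) chart set \<Rightarrow>
     (nat set \<Rightarrow> ('m, 'r, 'n) family \<Rightarrow> bool) \<Rightarrow> bool"
  where "decay_condition \<A> decay \<longleftrightarrow>
    (compact (UNIV :: 'm set) \<longrightarrow> (\<forall>I h. smooth_family \<A> I h \<longrightarrow> decay I h)) \<and>
    (\<forall>I. decay I (\<lambda>c. 0)) \<and>
    (\<forall>I g h. decay I g \<longrightarrow> decay I h \<longrightarrow> decay I (\<lambda>c. g c + h c)) \<and>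
    (\<forall>I r h. decay I h \<longrightarrow> decay I (\<lambda>c. scale (\<lambda>_. r) (h c)))"

definition scalar_density ::
    "('m::topological_space, 'n::finite) chart set \<Rightarrow>
     (nat set \<Rightarrow> ('m, 'r, 'n) family \<Rightarrow> bool) \<Rightarrow> nat set \<Rightarrow> ('m, 'r, 'n) family \<Rightarrow> bool"
  where "scalar_density \<A> decay I h \<longleftrightarrow>
    smooth_family \<A> I h \<and> decay I h \<and>
    (\<forall>c\<in>chart_tuples \<A>. \<forall>d\<in>chart_tuples \<A>. \<forall>x\<in>tuple_domain c I \<inter> tuple_domain d I.
       cyclic_eq (at_point (h d) x)
         (coordinate_change (tuple_jacobian c d x) (at_point (h c) x)))"

text \<open>A vector field along the \<open>\<alpha>\<close>-th copy of the manifold, with components \<open>g k\<close>.\<close>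

definition vector_density ::
    "('m::topological_space, 'n::finite) chart set \<Rightarrow>
     (nat set \<Rightarrow> ('m, 'r, 'n) family \<Rightarrow> bool) \<Rightarrow> nat set \<Rightarrow> nat \<Rightarrow>
     ('n \<Rightarrow> ('m, 'r, 'n) family) \<Rightarrow> bool"
  where "vector_density \<A> decay I \<alpha> g \<longleftrightarrow>
    (\<forall>k. smooth_family \<A> I (g k) \<and> decay I (g k)) \<and>
    (\<forall>c\<in>chart_tuples \<A>. \<forall>d\<in>chart_tuples \<A>. \<forall>x\<in>tuple_domain c I \<inter> tuple_domain d I. \<forall>l.
       cyclic_eq (at_point (g l d) x)
         (coordinate_change (tuple_jacobian c d x)
           (\<Sum>k\<in>UNIV. scale (tuple_jacobian c d x \<alpha> $ l $ k) (at_point (g k c) x))))"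

text \<open>\<open>h\<close> times the product of the volume elements is a sum of exact top-degree forms along
  the copies of the manifold, i.e. the integral of \<open>h\<close> vanishes after integration by parts.
  The divergence of \<open>g\<close> is taken with respect to the volume element; if the latter is constant
  in affine coordinates, this is \<open>\<Sum>k. D\<^sub>k g\<^sup>k\<close>.\<close>

definition divergence ::
    "(('m, 'n::finite) chart \<Rightarrow> 'm \<Rightarrow> real) \<Rightarrow> (nat \<Rightarrow> ('m, 'n) chart) \<Rightarrow> nat \<Rightarrow>
     ('n \<Rightarrow> ('m, 'r, 'n) family) \<Rightarrow> ('m, 'r, 'n) expr"
  where "divergence vol c \<alpha> g =
    scale (\<lambda>x. 1 / vol (c \<alpha>) (x \<alpha>))
      (\<Sum>k\<in>UNIV. total_deriv c \<alpha> k (scale (\<lambda>x. vol (c \<alpha>) (x \<alpha>)) (g k c)))"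

definition integrates_to_zero ::
    "('m::topological_space, 'n::finite) chart set \<Rightarrow> (('m, 'n) chart \<Rightarrow> 'm \<Rightarrow> real) \<Rightarrow>
     (nat set \<Rightarrow> ('m, 'r, 'n) family \<Rightarrow> bool) \<Rightarrow> nat set \<Rightarrow> ('m, 'r, 'n) family \<Rightarrow> bool"
  where "integrates_to_zero \<A> vol decay I h \<longleftrightarrow>
    (\<exists>g. (\<forall>\<alpha>\<in>I. vector_density \<A> decay I \<alpha> (g \<alpha>)) \<and>
      (\<forall>c\<in>chart_tuples \<A>. \<forall>x\<in>tuple_domain c I.
         cyclic_eq (at_point (h c) x) (at_point (\<Sum>\<alpha>\<in>I. divergence vol c \<alpha> (g \<alpha>)) x)))"


section \<open>Local functionals\<close>

text \<open>Products of integral functionals, one for each label in \<open>I\<close>, with any bracketing.\<close>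

inductive_set product_densities ::
    "('m::topological_space, 'n::finite) chart set \<Rightarrow>
     (nat set \<Rightarrow> ('m, 'r, 'n) family \<Rightarrow> bool) \<Rightarrow> (nat set \<times> ('m, 'r, 'n) family) set"
  for \<A> decay
  where
    empty_product: "({}, \<lambda>c. Poly_Mapping.single [] 1) \<in> product_densities \<A> decay"
  | factor: "scalar_density \<A> decay {\<alpha>} f \<Longrightarrow> ({\<alpha>}, f) \<in> product_densities \<A> decay"
  | product: "(I, f) \<in> product_densities \<A> decay \<Longrightarrow> (J, g) \<in> product_densities \<A> decay \<Longrightarrow>
      I \<inter> J = {} \<Longrightarrow> (I \<union> J, \<lambda>c. cyclic_times (f c) (g c)) \<in> product_densities \<A> decay"

definition product_combinations ::
    "('m::topological_space, 'n::finite) chart set \<Rightarrow>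
     (nat set \<Rightarrow> ('m, 'r, 'n) family \<Rightarrow> bool) \<Rightarrow> nat set \<Rightarrow> ('m, 'r, 'n) family set"
  where "product_combinations \<A> decay I =
    {h. \<exists>N r u. (\<forall>j<N. (I, u j) \<in> product_densities \<A> decay) \<and>
        h = (\<lambda>c. \<Sum>j<(N::nat). scale (\<lambda>_. r j) (u j c))}"

text \<open>The operator identifies copies of the manifold along diagonals, so densities are indexed
  by equivalence relations \<open>E\<close> on a set \<open>Field E\<close> of labels: the component at \<open>E\<close> is a density
  over the copies labelled by the least elements of the blocks of \<open>E\<close>.  A local functional is
  a finite sum of components at the identity relations on \<open>{..<\<ell>}\<close>, \<open>\<ell> \<ge> 0\<close>.\<close>

type_synonym ('m, 'r, 'n) functional_density = "nat rel \<Rightarrow> ('m, 'r, 'n) family"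

definition rep :: "nat rel \<Rightarrow> nat \<Rightarrow> nat"
  where "rep E \<alpha> = (if \<alpha> \<in> Field E then LEAST \<beta>. (\<alpha>, \<beta>) \<in> E else \<alpha>)"

definition int_by_parts ::
    "('m::topological_space, 'n::finite) chart set \<Rightarrow> (('m, 'n) chart \<Rightarrow> 'm \<Rightarrow> real) \<Rightarrow>
     (nat set \<Rightarrow> ('m, 'r, 'n) family \<Rightarrow> bool) \<Rightarrow> ('m, 'r, 'n) functional_density rel"
  where "int_by_parts \<A> vol decay =
    {(F, G). \<forall>E. integrates_to_zero \<A> vol decay (rep E ` Field E) (\<lambda>c. F E c - G E c)}"

definition local_densities ::
    "('m::topological_space, 'n::finite) chart set \<Rightarrow>
     (nat set \<Rightarrow> ('m, 'r, 'n) family \<Rightarrow> bool) \<Rightarrow> ('m, 'r, 'n) functional_density set"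
  where "local_densities \<A> decay =
    {F. finite {E. F E \<noteq> (\<lambda>c. 0)} \<and>
        (\<forall>l. F (Id_on {..<l}) \<in> product_combinations \<A> decay {..<l}) \<and>
        (\<forall>E. E \<notin> range (\<lambda>l. Id_on {..<l}) \<longrightarrow> F E = (\<lambda>c. 0))}"

definition local_functionals ::
    "('m::topological_space, 'n::finite) chart set \<Rightarrow> (('m, 'n) chart \<Rightarrow> 'm \<Rightarrow> real) \<Rightarrow>
     (nat set \<Rightarrow> ('m, 'r, 'n) family \<Rightarrow> bool) \<Rightarrow> ('m, 'r, 'n) functional_density set set"
  where "local_functionals \<A> vol decay =
    local_densities \<A> decay // Restr (int_by_parts \<A> vol decay) (local_densities \<A> decay)"

definition zero_functional ::
    "('m::topological_space, 'n::finite) chart set \<Rightarrow> (('m, 'n) chart \<Rightarrow> 'm \<Rightarrow> real) \<Rightarrow>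
     (nat set \<Rightarrow> ('m, 'r, 'n) family \<Rightarrow> bool) \<Rightarrow> ('m, 'r, 'n) functional_density set"
  where "zero_functional \<A> vol decay = int_by_parts \<A> vol decay `` {\<lambda>E c. 0}"


section \<open>The Batalin--Vilkovisky Laplacian\<close>

text \<open>A summand \<open>single (p, E) h\<close> of a pending expression stands for: apply to \<open>h\<close> the total
  derivatives \<open>D\<close> along the \<open>\<alpha>\<close>-th copy and \<open>k\<close>-th coordinate for all \<open>(\<alpha>, k) \<in># p\<close>, and then
  restrict to the diagonal on which the copies related by \<open>E\<close> coincide.  When the operator is
  iterated, both are postponed until all partial derivatives have acted.\<close>

type_synonym ('m, 'r, 'n) pending = "((nat \<times> 'n) multiset \<times> nat rel) \<Rightarrow>\<^sub>0 ('m, 'r, 'n) expr"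

definition identify :: "nat \<Rightarrow> nat \<Rightarrow> nat rel \<Rightarrow> nat rel"
  where "identify \<alpha> \<beta> E = (E \<union> {(\<alpha>, \<beta>), (\<beta>, \<alpha>)})\<^sup>+"

text \<open>Only finitely many pairs \<open>\<sigma>, \<tau>\<close> contribute to the sums over all multi-indices.\<close>

definition bv_partial ::
    "('m, 'r::finite, 'n) pending \<Rightarrow> ('m, 'r, 'n) pending"
  where "bv_partial P = (\<Sum>(p, E)\<in>Poly_Mapping.keys P. \<Sum>\<alpha>\<in>Field E. \<Sum>\<beta>\<in>Field E. \<Sum>i\<in>UNIV.
    Sum_any (\<lambda>(\<sigma>, \<tau>).
      Poly_Mapping.single
        (p + image_mset (Pair \<alpha>) \<sigma> + image_mset (Pair \<beta>) \<tau>, identify \<alpha> \<beta> E)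
        (scale ((- 1) ^ (size \<sigma> + size \<tau>))
          (letter_deriv (\<alpha>, A i \<sigma>) (letter_deriv (\<beta>, B i \<tau>) (Poly_Mapping.lookup P (p, E)))))))"

text \<open>Total derivatives commute on smooth expressions, so the enumeration of \<open>p\<close> is
  immaterial.\<close>

definition total_derivs ::
    "(nat \<Rightarrow> ('m, 'n::finite) chart) \<Rightarrow> (nat \<times> 'n) multiset \<Rightarrow>
     ('m, 'r, 'n) expr \<Rightarrow> ('m, 'r, 'n) expr"
  where "total_derivs c p = fold (\<lambda>(\<alpha>, k). total_deriv c \<alpha> k) (SOME ds. mset ds = p)"

text \<open>On the diagonal, letters and coefficients of identified copies are taken at the same
  point; all labels in a block of \<open>E\<close> are replaced by its representative.\<close>

definition restrict_diagonal :: "nat rel \<Rightarrow> ('m, 'r, 'n) expr \<Rightarrow> ('m, 'r, 'n) expr"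
  where "restrict_diagonal E h = (\<Sum>w\<in>Poly_Mapping.keys h.
    Poly_Mapping.single (map (\<lambda>(\<alpha>, l). (rep E \<alpha>, l)) w)
      (\<lambda>x. Poly_Mapping.lookup h w (x \<circ> rep E)))"

definition evaluate ::
    "(nat \<Rightarrow> ('m, 'n::finite) chart) \<Rightarrow> nat rel \<Rightarrow> ('m, 'r, 'n) pending \<Rightarrow> ('m, 'r, 'n) expr"
  where "evaluate c E P = (\<Sum>p\<in>{p. (p, E) \<in> Poly_Mapping.keys P}.
    restrict_diagonal E (total_derivs c p (Poly_Mapping.lookup P (p, E))))"

text \<open>The \<open>N\<close>-th iterate of the operator on densities.  Identified copies use the same chart.\<close>

definition bv_density ::
    "nat \<Rightarrow> ('m, 'r::finite, 'n::finite) functional_density \<Rightarrow> ('m, 'r, 'n) functional_density"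
  where "bv_density N F E c =
    evaluate (c \<circ> rep E) E
      ((bv_partial ^^ N)
        (Poly_Mapping.single ({#}, Id_on (Field E)) (F (Id_on (Field E)) (c \<circ> rep E))))"

text \<open>The induced map on classes modulo integration by parts: \<open>N = 1\<close> is the operator itself,
  \<open>N = 2\<close> its square.\<close>

definition bv_laplacian_power ::
    "('m::topological_space, 'n::finite) chart set \<Rightarrow> (('m, 'n) chart \<Rightarrow> 'm \<Rightarrow> real) \<Rightarrow>
     (nat set \<Rightarrow> ('m, 'r::finite, 'n) family \<Rightarrow> bool) \<Rightarrow> nat \<Rightarrow>
     ('m, 'r, 'n) functional_density set \<Rightarrow> ('m, 'r, 'n) functional_density set"
  where "bv_laplacian_power \<A> vol decay N X =
    (\<Union>F\<in>X. int_by_parts \<A> vol decay `` {bv_density N F})"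

end

theory Submission
  imports Defs
begin

text \<open>
  All partial derivatives act before any total derivative or restriction to a diagonal, so
  \<open>\<Delta>\<^sup>2\<close> can be examined before these are carried out, and there it vanishes identically on each
  word.  One application of \<open>\<Delta>\<close> is a sum over contractions \<open>x = (\<alpha>, \<beta>, i, \<sigma>, \<tau>)\<close>: delete a letter
  \<open>a\<^sup>i\<^sub>\<sigma>\<close> of the factor \<open>\<alpha>\<close> and a letter \<open>b\<^sub>i\<^sub>,\<^sub>\<tau>\<close> of the factor \<open>\<beta>\<close>, and record the
  postponed total derivatives and the identification of \<open>\<alpha>\<close> with \<open>\<beta>\<close>.  Hence \<open>\<Delta>\<^sup>2\<close> is a sum over
  ordered pairs \<open>(x, y)\<close> of contractions.  Exchanging \<open>x\<close> and \<open>y\<close> changes the sign of the remaining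
  word, because deletions of two odd letters anticommute while deletions of even letters commute
  with everything (\<open>letter_deriv_commute\<close>, \<open>contract_anticommute\<close>).  It does not change the
  record: the postponed derivatives form a multiset, and the equivalence relation generated by two
  identifications does not depend on their order (\<open>postpone_commute\<close>).  The sum therefore equals
  its own negative, and it is zero since the coefficients are real functions.

  Thus \<open>\<Delta>\<^sup>2\<close> maps every density to zero itself, not only to zero up to integration by parts.  To
  conclude for classes it remains to see that a class has a member, which follows from
  reflexivity of equality modulo integration by parts (\<open>local_functional_nonempty\<close>).
\<close>

section \<open>Additive maps on finitely supported functions\<close>

text \<open>Operators on expressions are defined by sums over the support.  Enlarging the support adds
  only zero terms, so two expressions may be expanded over the union of their supports; this is
  why all these operators are additive.\<close>

lemma additive_sum_keys:
  fixes \<phi> :: "'k \<Rightarrow> 'c::ab_group_add \<Rightarrow> 'd::ab_group_add"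
  assumes "\<And>k. Modules.additive (\<phi> k)"
  shows "Modules.additive (\<lambda>h. \<Sum>k\<in>Poly_Mapping.keys h. \<phi> k (Poly_Mapping.lookup h k))"
proof
  fix f g :: "'k \<Rightarrow>\<^sub>0 'c"
  let ?K = "Poly_Mapping.keys f \<union> Poly_Mapping.keys g"
  have zero: "\<phi> k 0 = 0" for k
    using assms by (rule additive.zero)
  have expand: "(\<Sum>k\<in>Poly_Mapping.keys h. \<phi> k (Poly_Mapping.lookup h k)) =
      (\<Sum>k\<in>?K. \<phi> k (Poly_Mapping.lookup h k))" if "Poly_Mapping.keys h \<subseteq> ?K" for h
    using that by (intro sum.mono_neutral_left) (auto simp: zero in_keys_iff)
  show "(\<Sum>k\<in>Poly_Mapping.keys (f + g). \<phi> k (Poly_Mapping.lookup (f + g) k)) =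
      (\<Sum>k\<in>Poly_Mapping.keys f. \<phi> k (Poly_Mapping.lookup f k)) +
      (\<Sum>k\<in>Poly_Mapping.keys g. \<phi> k (Poly_Mapping.lookup g k))"
    unfolding expand[OF Poly_Mapping.keys_add] expand[OF Un_upper1] expand[OF Un_upper2]
    by (simp add: lookup_add additive.add[OF assms] sum.distrib)
qed

lemma sum_keys_single:
  fixes \<phi> :: "'k \<Rightarrow> 'c::ab_group_add \<Rightarrow> 'd::ab_group_add"
  assumes "\<And>k. Modules.additive (\<phi> k)"
  shows "(\<Sum>j\<in>Poly_Mapping.keys (Poly_Mapping.single k a).
    \<phi> j (Poly_Mapping.lookup (Poly_Mapping.single k a) j)) = \<phi> k a"
  using additive.zero[OF assms] by (cases "a = 0") auto

lemma additive_sum: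
  "(\<And>i. i \<in> I \<Longrightarrow> Modules.additive (f i)) \<Longrightarrow> Modules.additive (\<lambda>h. \<Sum>i\<in>I. f i h)"
  by (simp add: Modules.additive_def sum.distrib)

lemma additive_single: "Modules.additive (Poly_Mapping.single k)"
  by (simp add: Modules.additive_def single_add)

lemma additive_single_times:
  "Modules.additive (\<lambda>a::'c::comm_ring_1. Poly_Mapping.single k (c * a))"
  by (simp add: Modules.additive_def single_add algebra_simps)

lemma lookup_scale [simp]: "Poly_Mapping.lookup (scale c h) k = c * Poly_Mapping.lookup h k"
  by (simp add: scale_def map.rep_eq when_def)

lemma scale_scale: "scale c (scale d h) = scale (c * d) h"
  by (rule poly_mapping_eqI) (simp add: mult.assoc)

lemma scale_single [simp]: "scale c (Poly_Mapping.single k a) = Poly_Mapping.single k (c * a)"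
  by (rule poly_mapping_eqI) (simp add: lookup_single when_def)

lemma additive_scale: "Modules.additive (scale c)"
  by standard (rule poly_mapping_eqI, simp add: lookup_add algebra_simps)

lemma scale_one [simp]: "scale 1 h = h"
  by (rule poly_mapping_eqI) simp

lemma scale_minus_one [simp]: "scale (- 1) h = - h"
  by (rule poly_mapping_eqI) simp

text \<open>Identities between additive operators need to be verified on single words only.\<close>

lemma additive_eqI:
  assumes "Modules.additive f" "Modules.additive g"
    and single: "\<And>k a. f (Poly_Mapping.single k a) = g (Poly_Mapping.single k a)"
  shows "f h = g h"
proof (induction h rule: update_induct)
  case const
  then show ?case
    using assms(1,2) by (simp add: additive.zero)
next
  case (update h k a)
  have "Poly_Mapping.update k a h = h + Poly_Mapping.single k a"
    using update(1) by (intro poly_mapping_eqI)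
      (auto simp: lookup_update lookup_add lookup_single when_def in_keys_iff)
  then show ?case
    using update(3) single by (simp add: additive.add[OF assms(1)] additive.add[OF assms(2)])
qed


section \<open>Letter derivatives\<close>

lemma additive_letter_deriv: "Modules.additive (letter_deriv l)"
  unfolding letter_deriv_def
  by (intro additive_sum_keys additive_sum additive_single_times)

lemma letter_deriv_single:
  "letter_deriv l (Poly_Mapping.single w a) = (\<Sum>\<nu> | \<nu> < length w \<and> w ! \<nu> = l.
    Poly_Mapping.single (take \<nu> w @ drop (Suc \<nu>) w)
      ((- 1) ^ (word_degree [l] * word_degree (take \<nu> w)) * a))"
  unfolding letter_deriv_def
  by (rule sum_keys_single) (intro additive_sum additive_single_times)

text \<open>Multiplication by a letter from the left.  It generates all words from the empty one, which
  makes induction over words available for the signs of iterated letter derivatives.\<close>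

definition prepend ::
    "nat \<times> ('r, 'n) jet_letter \<Rightarrow> ('m, 'r, 'n) expr \<Rightarrow> ('m, 'r, 'n) expr"
  where "prepend x h = (\<Sum>w\<in>Poly_Mapping.keys h.
    Poly_Mapping.single (x # w) (Poly_Mapping.lookup h w))"

lemma additive_prepend: "Modules.additive (prepend x)"
  unfolding prepend_def by (intro additive_sum_keys additive_single)

lemma prepend_single: "prepend x (Poly_Mapping.single w a) = Poly_Mapping.single (x # w) a"
  unfolding prepend_def by (rule sum_keys_single) (rule additive_single)

lemmas expr_add = additive.add[OF additive_scale] additive.add[OF additive_prepend]
  additive.add[OF additive_letter_deriv]

lemmas expr_zero = additive.zero[OF additive_scale] additive.zero[OF additive_prepend]
  additive.zero[OF additive_letter_deriv]

lemma prepend_scale: "prepend x (scale c h) = scale c (prepend x h)"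
  by (rule additive_eqI[where h = h]) (simp_all add: Modules.additive_def expr_add prepend_single)

lemma letter_deriv_scale: "letter_deriv l (scale c h) = scale c (letter_deriv l h)"
  by (rule additive_eqI[where h = h])
    (simp_all add: Modules.additive_def expr_add letter_deriv_single
      additive.sum[OF additive_scale] mult.left_commute)

definition koszul_sign ::
    "nat \<times> ('r, 'n) jet_letter \<Rightarrow> nat \<times> ('r, 'n) jet_letter \<Rightarrow> 'c::comm_ring_1"
  where "koszul_sign x y = (- 1) ^ (word_degree [x] * word_degree [y])"

lemma koszul_sign_commute: "koszul_sign x y = koszul_sign y x"
  by (simp add: koszul_sign_def mult.commute)

lemma koszul_sign_square [simp]: "koszul_sign x y * koszul_sign x y = 1"
  by (simp add: koszul_sign_def flip: power_add mult_2)

lemma word_degree_Cons: "word_degree (x # w) = word_degree [x] + word_degree w"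
  by (simp add: word_degree_def)

text \<open>The graded Leibniz rule for a letter in front: either this letter is deleted, without a
  sign, or a later one is, after the derivative has passed the front letter.\<close>

lemma letter_deriv_prepend_single:
  "letter_deriv l (Poly_Mapping.single (x # w) a) =
    (if x = l then Poly_Mapping.single w a else 0) +
    scale (koszul_sign l x) (prepend x (letter_deriv l (Poly_Mapping.single w a)))"
proof -
  let ?N = "{\<nu>. \<nu> < length w \<and> w ! \<nu> = l}"
  let ?t = "\<lambda>\<nu>. Poly_Mapping.single (take \<nu> (x # w) @ drop (Suc \<nu>) (x # w))
      ((- 1) ^ (word_degree [l] * word_degree (take \<nu> (x # w))) * a)"
  have positions: "{\<nu>. \<nu> < length (x # w) \<and> (x # w) ! \<nu> = l} =
      (if x = l then {0} else {}) \<union> Suc ` ?N"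
    by (auto simp: image_iff less_Suc_eq_0_disj)
  have "letter_deriv l (Poly_Mapping.single (x # w) a) =
      sum ?t (if x = l then {0} else {}) + sum ?t (Suc ` ?N)"
    unfolding letter_deriv_single positions by (rule sum.union_disjoint) auto
  also have "sum ?t (if x = l then {0} else {}) =
      (if x = l then Poly_Mapping.single w a else 0)"
    by (simp add: word_degree_def)
  also have "sum ?t (Suc ` ?N) =
      scale (koszul_sign l x) (prepend x (letter_deriv l (Poly_Mapping.single w a)))"
    by (simp add: sum.reindex letter_deriv_single additive.sum[OF additive_prepend]
        additive.sum[OF additive_scale] prepend_single koszul_sign_def word_degree_Cons[of x "take _ _"]
        distrib_left power_add mult.assoc)
  finally show ?thesis .
qed

lemma letter_deriv_prepend:
  "letter_deriv l (prepend x h) =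
    (if x = l then h else 0) + scale (koszul_sign l x) (prepend x (letter_deriv l h))"
  by (rule additive_eqI[where h = h])
    (simp_all add: Modules.additive_def expr_add prepend_single letter_deriv_prepend_single)

text \<open>Induction over the word.  By the Leibniz rule the composition of two derivatives has three
  parts: one letter is in front and the other behind it (two ways), or both are behind.  In the
  first two parts the sign of the reordering arises because the derivative that deletes the later
  letter passes the front letter only if it acts before that letter is deleted; the third part is
  the induction hypothesis.\<close>

lemma letter_deriv_commute:
  fixes h :: "('m, 'r, 'n) expr"
  shows "letter_deriv l (letter_deriv l' h) =
    scale (koszul_sign l l') (letter_deriv l' (letter_deriv l h))"
proof (rule additive_eqI[where h = h])
  fix w :: "('r, 'n) word" and a :: "'m coeff"
  show "letter_deriv l (letter_deriv l' (Poly_Mapping.single w a)) =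
    scale (koszul_sign l l') (letter_deriv l' (letter_deriv l (Poly_Mapping.single w a)))"
  proof (induction w)
    case Nil
    then show ?case
      by (simp add: letter_deriv_single expr_zero)
  next
    case (Cons x w)
    let ?h = "Poly_Mapping.single w a"
    have expand: "letter_deriv k (letter_deriv k' (Poly_Mapping.single (x # w) a)) =
        (if x = k' then letter_deriv k ?h else 0) +
        (if x = k then scale (koszul_sign k' x) (letter_deriv k' ?h) else 0) +
        scale (koszul_sign k' x * koszul_sign k x)
          (prepend x (letter_deriv k (letter_deriv k' ?h)))" for k k'
      by (simp add: letter_deriv_prepend_single letter_deriv_prepend letter_deriv_scale
          expr_add expr_zero scale_scale add.assoc)
    show ?case
      unfolding expand Cons.IH
      by (auto simp: expr_add expr_zero scale_scale prepend_scale koszul_sign_commute ac_simps)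
  qed
qed (simp_all add: Modules.additive_def expr_add)

lemma letter_deriv_even_commute:
  "letter_deriv (\<alpha>, A i \<sigma>) (letter_deriv l h) = letter_deriv l (letter_deriv (\<alpha>, A i \<sigma>) h)"
  by (subst letter_deriv_commute) (simp add: koszul_sign_def word_degree_def)

lemma letter_deriv_odd_anticommute:
  "letter_deriv (\<alpha>, B i \<sigma>) (letter_deriv (\<beta>, B j \<tau>) h) =
    - letter_deriv (\<beta>, B j \<tau>) (letter_deriv (\<alpha>, B i \<sigma>) h)"
  by (subst letter_deriv_commute) (simp add: koszul_sign_def word_degree_def)

text \<open>Only letters that occur in the expression can be deleted.  This makes the sums over all
  multi-indices finite.\<close>

lemma finite_letter_derivs: "finite {l. letter_deriv l h \<noteq> 0}"
proof (rule finite_subset)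
  show "{l. letter_deriv l h \<noteq> 0} \<subseteq> (\<Union>w\<in>Poly_Mapping.keys h. set w)"
  proof (rule subsetI, rule ccontr)
    fix l assume "l \<in> {l. letter_deriv l h \<noteq> 0}"
      and l: "l \<notin> (\<Union>w\<in>Poly_Mapping.keys h. set w)"
    then have "w ! \<nu> \<noteq> l" if "w \<in> Poly_Mapping.keys h" "\<nu> < length w" for w \<nu>
      using that by auto
    then have "letter_deriv l h = 0"
      unfolding letter_deriv_def by (auto intro!: sum.neutral)
    then show False
      using \<open>l \<in> _\<close> by simp
  qed
qed auto


section \<open>Contractions of conjugate letters\<close>

text \<open>A contraction \<open>(\<alpha>, \<beta>, i, \<sigma>, \<tau>)\<close> stands for one summand of the operator.  Its effect is split
  into \<open>contract\<close>, which acts on the density and is odd, and \<open>postpone\<close>, which acts on the record of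
  pending operations and is even.\<close>

type_synonym ('r, 'n) contraction = "nat \<times> nat \<times> 'r \<times> 'n multiset \<times> 'n multiset"

fun contract :: "('r, 'n) contraction \<Rightarrow> ('m, 'r, 'n) expr \<Rightarrow> ('m, 'r, 'n) expr"
  where "contract (\<alpha>, \<beta>, i, \<sigma>, \<tau>) h =
    scale ((- 1) ^ (size \<sigma> + size \<tau>)) (letter_deriv (\<alpha>, A i \<sigma>) (letter_deriv (\<beta>, B i \<tau>) h))"

fun postpone ::
    "('r, 'n) contraction \<Rightarrow> (nat \<times> 'n) multiset \<times> nat rel \<Rightarrow> (nat \<times> 'n) multiset \<times> nat rel"
  where "postpone (\<alpha>, \<beta>, i, \<sigma>, \<tau>) (p, E) =
    (p + image_mset (Pair \<alpha>) \<sigma> + image_mset (Pair \<beta>) \<tau>, identify \<alpha> \<beta> E)"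

lemma additive_contract: "Modules.additive (contract x)"
  by (cases x) (simp add: Modules.additive_def expr_add)

text \<open>Each contraction contains exactly one odd derivative, so only the exchange of the two odd
  derivatives contributes a sign.\<close>

lemma contract_anticommute: "contract x (contract y h) = - contract y (contract x h)"
proof -
  obtain \<alpha> \<beta> i \<sigma> \<tau> where x: "x = (\<alpha>, \<beta>, i, \<sigma>, \<tau>)"
    by (cases x)
  obtain \<alpha>' \<beta>' i' \<sigma>' \<tau>' where y: "y = (\<alpha>', \<beta>', i', \<sigma>', \<tau>')"
    by (cases y)
  let ?a = "letter_deriv (\<alpha>, A i \<sigma>)" and ?b = "letter_deriv (\<beta>, B i \<tau>)"
  let ?a' = "letter_deriv (\<alpha>', A i' \<sigma>')" and ?b' = "letter_deriv (\<beta>', B i' \<tau>')"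
  have even: "?b (?a' z) = ?a' (?b z)" "?a (?a' z) = ?a' (?a z)" "?b' (?a z) = ?a (?b' z)" for z
    by (rule letter_deriv_even_commute letter_deriv_even_commute[symmetric])+
  have "?a (?b (?a' (?b' h))) = ?a' (?a (?b (?b' h)))"
    by (simp only: even)
  also have "\<dots> = - ?a' (?a (?b' (?b h)))"
    by (simp only: letter_deriv_odd_anticommute[of \<beta> i \<tau> \<beta>' i' \<tau>' h]
        additive.minus[OF additive_letter_deriv])
  also have "?a' (?a (?b' (?b h))) = ?a' (?b' (?a (?b h)))"
    by (simp only: even)
  finally show ?thesis
    by (simp add: x y letter_deriv_scale scale_scale additive.minus[OF additive_scale]
        mult.commute)
qed

text \<open>An intermediate transitive closure is absorbed by the next one; the right-hand side is
  visibly symmetric in the two identifications.\<close>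

lemma identify_identify: "identify \<alpha> \<beta> (identify \<gamma> \<delta> E) =
    (E \<union> {(\<alpha>, \<beta>), (\<beta>, \<alpha>)} \<union> {(\<gamma>, \<delta>), (\<delta>, \<gamma>)})\<^sup>+"
proof -
  have closure: "(R\<^sup>+ \<union> S)\<^sup>+ = (R \<union> S)\<^sup>+" for R S :: "nat rel"
  proof
    have "R\<^sup>+ \<union> S \<subseteq> (R \<union> S)\<^sup>+"
      using trancl_mono_subset[of R "R \<union> S"] by auto
    then have "(R\<^sup>+ \<union> S)\<^sup>+ \<subseteq> ((R \<union> S)\<^sup>+)\<^sup>+"
      by (rule trancl_mono_subset)
    then show "(R\<^sup>+ \<union> S)\<^sup>+ \<subseteq> (R \<union> S)\<^sup>+"
      by simp
    show "(R \<union> S)\<^sup>+ \<subseteq> (R\<^sup>+ \<union> S)\<^sup>+"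
      by (rule trancl_mono_subset) auto
  qed
  show ?thesis
    unfolding identify_def closure by (rule arg_cong[where f = trancl]) blast
qed

lemma postpone_commute: "postpone x (postpone y k) = postpone y (postpone x k)"
proof -
  obtain \<alpha> \<beta> i \<sigma> \<tau> where x: "x = (\<alpha>, \<beta>, i, \<sigma>, \<tau>)"
    by (cases x)
  obtain \<alpha>' \<beta>' i' \<sigma>' \<tau>' where y: "y = (\<alpha>', \<beta>', i', \<sigma>', \<tau>')"
    by (cases y)
  obtain p E where k: "k = (p, E)"
    by (cases k)
  show ?thesis
    by (simp add: x y k identify_identify Un_ac ac_simps)
qed

text \<open>Identifying factors creates no labels and removes none, so both applications of the operator
  run over the same factors.\<close>

lemma Field_identify: "\<alpha> \<in> Field E \<Longrightarrow> \<beta> \<in> Field E \<Longrightarrow> Field (identify \<alpha> \<beta> E) = Field E"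
  by (auto simp: identify_def Field_def)


section \<open>The square of the operator\<close>

definition contractions :: "nat rel \<Rightarrow> 'n multiset set \<Rightarrow> ('r, 'n) contraction set"
  where "contractions E M = Field E \<times> Field E \<times> UNIV \<times> M \<times> M"

text \<open>Phrased through derivatives rather than occurrences of letters, the condition is inherited
  along contractions simply because derivatives commute up to sign
  (\<open>indices_within_contract\<close>).\<close>

definition indices_within :: "'n multiset set \<Rightarrow> ('m, 'r, 'n) expr \<Rightarrow> bool"
  where "indices_within M h \<longleftrightarrow>
    (\<forall>\<alpha> i \<sigma>. letter_deriv (\<alpha>, A i \<sigma>) h \<noteq> 0 \<or> letter_deriv (\<alpha>, B i \<sigma>) h \<noteq> 0 \<longrightarrow> \<sigma> \<in> M)"

lemma indices_within_mono: "indices_within M h \<Longrightarrow> M \<subseteq> M' \<Longrightarrow> indices_within M' h"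
  by (auto simp: indices_within_def)

lemma ex_indices_within: "\<exists>M. finite M \<and> indices_within M h"
proof -
  let ?index = "\<lambda>l :: nat \<times> ('r, 'n) jet_letter. case snd l of A i \<sigma> \<Rightarrow> \<sigma> | B i \<sigma> \<Rightarrow> \<sigma>"
  have "indices_within (?index ` {l. letter_deriv l h \<noteq> 0}) h"
    by (force simp: indices_within_def image_iff)
  then show ?thesis
    using finite_letter_derivs by blast
qed

lemma indices_within_contract:
  assumes "indices_within M h"
  shows "indices_within M (contract x h)"
proof -
  obtain \<alpha> \<beta> i \<sigma> \<tau> where x: "x = (\<alpha>, \<beta>, i, \<sigma>, \<tau>)"
    by (cases x)
  have "letter_deriv l (contract x h) = 0" if "letter_deriv l h = 0" for l
  proof -
    have "letter_deriv l (contract x h) = scale ((- 1) ^ (size \<sigma> + size \<tau>))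
        (letter_deriv (\<alpha>, A i \<sigma>) (letter_deriv l (letter_deriv (\<beta>, B i \<tau>) h)))"
      by (simp add: x letter_deriv_scale letter_deriv_even_commute)
    also have "letter_deriv l (letter_deriv (\<beta>, B i \<tau>) h) = 0"
      by (subst letter_deriv_commute) (simp add: that expr_zero)
    finally show ?thesis
      by (simp add: expr_zero)
  qed
  then show ?thesis
    using assms unfolding indices_within_def by metis
qed

text \<open>The contribution of one summand of a pending expression to the operator.  Any finite set of
  multi-indices that contains those of the density may replace the infinite range of summation;
  a common set for several densities then gives additivity and lets the double sum of the square
  run over a product of two equal finite ranges.\<close>

definition bv_term ::
    "(nat \<times> 'n) multiset \<times> nat rel \<Rightarrow> ('m, 'r::finite, 'n) expr \<Rightarrow> ('m, 'r, 'n) pending"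
  where "bv_term k h =
    (\<Sum>\<alpha>\<in>Field (snd k). \<Sum>\<beta>\<in>Field (snd k). \<Sum>i\<in>UNIV. Sum_any (\<lambda>(\<sigma>, \<tau>).
      Poly_Mapping.single (postpone (\<alpha>, \<beta>, i, \<sigma>, \<tau>) k) (contract (\<alpha>, \<beta>, i, \<sigma>, \<tau>) h)))"

lemma bv_term_eq_sum:
  assumes "finite M" "indices_within M h"
  shows "bv_term k h =
    (\<Sum>x\<in>contractions (snd k) M. Poly_Mapping.single (postpone x k) (contract x h))"
proof -
  let ?s = "\<lambda>x. Poly_Mapping.single (postpone x k) (contract x h)"
  have support: "{(\<sigma>, \<tau>). ?s (\<alpha>, \<beta>, i, \<sigma>, \<tau>) \<noteq> 0} \<subseteq> M \<times> M" for \<alpha> \<beta> i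
  proof -
    have "\<sigma> \<in> M \<and> \<tau> \<in> M" if "?s (\<alpha>, \<beta>, i, \<sigma>, \<tau>) \<noteq> 0" for \<sigma> \<tau>
    proof -
      have nz: "letter_deriv (\<alpha>, A i \<sigma>) (letter_deriv (\<beta>, B i \<tau>) h) \<noteq> 0"
        using that by (auto simp: expr_zero)
      then have "letter_deriv (\<beta>, B i \<tau>) h \<noteq> 0"
        by (auto simp: expr_zero)
      moreover have "letter_deriv (\<alpha>, A i \<sigma>) h \<noteq> 0"
        using nz by (auto simp: letter_deriv_even_commute expr_zero)
      ultimately show ?thesis
        using assms(2) by (auto simp: indices_within_def)
    qed
    then show ?thesis by blast
  qed
  have "Sum_any (\<lambda>(\<sigma>, \<tau>). ?s (\<alpha>, \<beta>, i, \<sigma>, \<tau>)) = (\<Sum>(\<sigma>, \<tau>)\<in>M \<times> M. ?s (\<alpha>, \<beta>, i, \<sigma>, \<tau>))"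
    for \<alpha> \<beta> i
    using assms(1) support[of \<alpha> \<beta> i]
    by (intro Sum_any.expand_superset) (auto simp: case_prod_unfold)
  then show ?thesis
    by (simp add: bv_term_def contractions_def sum.cartesian_product')
qed

lemma additive_bv_term:
  "Modules.additive (bv_term k :: ('m, 'r::finite, 'n) expr \<Rightarrow> _)"
proof
  fix g h :: "('m, 'r, 'n) expr"
  obtain M N where "finite M" "indices_within M g" "finite N" "indices_within N h"
    using ex_indices_within by blast
  then have fin: "finite (M \<union> N)"
    and M: "indices_within (M \<union> N) g" "indices_within (M \<union> N) h"
    by (auto elim: indices_within_mono)
  then have "indices_within (M \<union> N) (g + h)"
    unfolding indices_within_def additive.add[OF additive_letter_deriv] by (metis add_0)
  with M show "bv_term k (g + h) = bv_term k g + bv_term k h"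
    by (simp add: bv_term_eq_sum[OF fin] additive.add[OF additive_contract] single_add sum.distrib)
qed

lemma bv_partial_eq_sum:
  "bv_partial P = (\<Sum>k\<in>Poly_Mapping.keys P. bv_term k (Poly_Mapping.lookup P k))"
  unfolding bv_partial_def bv_term_def
  by (rule sum.cong) (auto intro!: sum.cong arg_cong[where f = Sum_any])

lemma additive_bv_partial:
  "Modules.additive (bv_partial :: ('m, 'r::finite, 'n) pending \<Rightarrow> _)"
  unfolding bv_partial_eq_sum[abs_def] by (rule additive_sum_keys) (rule additive_bv_term)

lemma bv_partial_single: "bv_partial (Poly_Mapping.single k h) = bv_term k h"
  unfolding bv_partial_eq_sum by (rule sum_keys_single) (rule additive_bv_term)

text \<open>There is no 2-torsion, since coefficients are real-valued.\<close>

lemma pending_eq_uminus_self: "P = 0" if "P = - P" for P :: "('m, 'r, 'n) pending"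
proof (intro poly_mapping_eqI ext)
  fix k w x
  have "Poly_Mapping.lookup (Poly_Mapping.lookup P k) w x =
      - Poly_Mapping.lookup (Poly_Mapping.lookup P k) w x"
    by (subst that) simp
  then show "Poly_Mapping.lookup (Poly_Mapping.lookup P k) w x =
      Poly_Mapping.lookup (Poly_Mapping.lookup 0 k) w x"
    by simp
qed

text \<open>The sum over pairs of contractions is antisymmetric under exchange of the pair.\<close>

lemma bv_partial_bv_partial_single:
  fixes h :: "('m, 'r::finite, 'n) expr"
  shows "bv_partial (bv_partial (Poly_Mapping.single k h)) = 0"
proof (rule pending_eq_uminus_self)
  obtain M where M: "finite M" "indices_within M h"
    using ex_indices_within by blast
  let ?C = "contractions (snd k) M"
  have field: "snd (postpone x k) = identify (fst x) (fst (snd x)) (snd k)"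
    for x :: "('r, 'n) contraction"
    by (cases x; cases k) simp
  have same: "contractions (snd (postpone x k)) M = ?C" if "x \<in> ?C"
    for x :: "('r, 'n) contraction"
    using that unfolding contractions_def field by (auto simp: Field_identify)
  have square: "bv_partial (bv_partial (Poly_Mapping.single k h)) = (\<Sum>x\<in>?C. \<Sum>y\<in>?C.
      Poly_Mapping.single (postpone y (postpone x k)) (contract y (contract x h)))"
    by (simp add: bv_partial_single bv_term_eq_sum[OF M] additive.sum[OF additive_bv_partial]
        bv_term_eq_sum[OF M(1) indices_within_contract[OF M(2)]] same)
  also have "\<dots> = (\<Sum>y\<in>?C. \<Sum>x\<in>?C.
      Poly_Mapping.single (postpone y (postpone x k)) (contract y (contract x h)))"
    by (rule sum.swap)
  also have "\<dots> = (\<Sum>y\<in>?C. \<Sum>x\<in>?C.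
      - Poly_Mapping.single (postpone x (postpone y k)) (contract x (contract y h)))"
    by (intro sum.cong refl) (subst contract_anticommute, subst postpone_commute, rule single_uminus)
  also have "\<dots> = - bv_partial (bv_partial (Poly_Mapping.single k h))"
    by (simp add: square sum_negf)
  finally show "bv_partial (bv_partial (Poly_Mapping.single k h)) =
    - bv_partial (bv_partial (Poly_Mapping.single k h))" .
qed

lemma bv_density_two: "bv_density 2 F = (\<lambda>E c. 0)"
  by (intro ext) (simp add: bv_density_def numeral_2_eq_2 bv_partial_bv_partial_single evaluate_def)


section \<open>Classes modulo integration by parts\<close>

lemma coeff_deriv_zero: "coeff_deriv c \<alpha> k (\<lambda>x. 0) = (\<lambda>x. 0)"
  by (rule ext) (simp add: coeff_deriv_def)

lemma smooth_coeff_zero: "smooth_coeff c I 0"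
proof -
  have "fold (\<lambda>(\<alpha>, k). coeff_deriv c \<alpha> k) ds (\<lambda>x. 0) = (\<lambda>x. 0)" for ds
    by (induction ds) (auto simp: coeff_deriv_zero)
  then show ?thesis
    by (simp add: smooth_coeff_def zero_fun_def)
qed

lemma smooth_family_zero: "smooth_family \<A> I (\<lambda>c. 0)"
  unfolding smooth_family_def by (auto simp: smooth_coeff_zero intro: exI[of _ "{}"])

lemma at_point_zero [simp]: "at_point 0 x = 0"
  by (rule poly_mapping_eqI) (simp add: at_point_def map.rep_eq)

lemma cyclic_eq_refl: "cyclic_eq p p"
  unfolding cyclic_eq_def by (rule exI[of _ 0]) (simp add: rotate_expr_def)

lemma vector_density_zero:
  assumes "decay_condition \<A> decay"
  shows "vector_density \<A> decay I \<alpha> (\<lambda>k c. 0)"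
proof -
  have "decay I (\<lambda>c. 0)"
    using assms by (simp add: decay_condition_def)
  then show ?thesis
    by (simp add: vector_density_def smooth_family_zero coordinate_change_def cyclic_eq_refl
        expr_zero)
qed

lemma divergence_zero: "divergence vol c \<alpha> (\<lambda>k c. 0) = 0"
  by (simp add: divergence_def total_deriv_def expr_zero)

text \<open>The zero vector fields exhibit the zero density as a divergence; they are admissible because
  every decay condition holds for zero.\<close>

lemma integrates_to_zero_zero:
  assumes "decay_condition \<A> decay"
  shows "integrates_to_zero \<A> vol decay I (\<lambda>c. 0)"
  unfolding integrates_to_zero_def
  by (rule exI[of _ "\<lambda>\<alpha> k c. 0"])
    (simp add: vector_density_zero[OF assms] divergence_zero cyclic_eq_refl)

text \<open>The operator maps a class to the union of the classes of the images of its members, and this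
  union would be empty for an empty class.\<close>

lemma local_functional_nonempty:
  assumes "decay_condition \<A> decay" "X \<in> local_functionals \<A> vol decay"
  shows "X \<noteq> {}"
proof -
  obtain F where F: "F \<in> local_densities \<A> decay"
    and X: "X = Restr (int_by_parts \<A> vol decay) (local_densities \<A> decay) `` {F}"
    using assms(2) by (auto simp: local_functionals_def quotient_def)
  have "(F, F) \<in> int_by_parts \<A> vol decay"
    using integrates_to_zero_zero[OF assms(1)] by (simp add: int_by_parts_def)
  then have "F \<in> X"
    using F X by blast
  then show ?thesis by blast
qed

theorem theorem15:
  fixes \<A> :: "('m::{t2_space, second_countable_topology}, 'n::finite) chart set"
    and vol :: "('m, 'n) chart \<Rightarrow> 'm \<Rightarrow> real"
    and decay :: "nat set \<Rightarrow> ('m, 'r::finite, 'n) family \<Rightarrow> bool"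
    and X :: "('m, 'r, 'n) functional_density set"
  assumes "oriented_affine_atlas \<A>"
    and "volume_element \<A> vol"
    and "decay_condition \<A> decay"
    and "X \<in> local_functionals \<A> vol decay"
  shows "bv_laplacian_power \<A> vol decay 2 X = zero_functional \<A> vol decay"
  using local_functional_nonempty[OF assms(3,4)]
  by (simp add: bv_laplacian_power_def zero_functional_def bv_density_two)

end
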